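(* Let $S=(X,V_{\mathsf w},w,f)$ be a discrete-time stochastic system with measurable labeling function $L:X\to\Pi$, where $\Pi=\{p_0,\ldots,p_M\}$ is a finite set of atomic propositions, and let $N\ge 1$ be an integer. Let $\varphi$ be a safe LTL$_F$ formula over $\Pi$, let $\mathcal{A}_{\neg\varphi}=(Q,Q_0,\Pi,\delta,F)$ be a DFA corresponding to its negation (i.e. accepting exactly the finite words over $\Pi$ that satisfy $\neg\varphi$), let $\mathcal{R}_{\le N+1}$ be the set of accepting state runs of $\mathcal{A}_{\neg\varphi}$ of length at most $N+1$ excluding self-loops, and for $\mathbf q\in\mathcal{R}_{\le N+1}$ let $\mathcal{P}(\mathbf q)$ be the set of state runs of length $3$ augmented with a horizon. For each $\mathbf q\in\mathcal{R}_{\le N+1}$ and each $\nu=(q,q',q'',T)\in\mathcal{P}(\mathbf q)$, let $\gamma_\nu\in[0,1]$ and $c_\nu\ge0$ be constants for which there is a measurable function $B_\nu:X\to[0,\infty)$ that is a $c_\nu$-martingale for $S$ and satisfies $B_\nu(x)\le\gamma_\nu$ for all $x\in L^{-1}(\sigma(q,q'))$ and $B_\nu(x)\ge 1$ for all $x\in L^{-1}(\sigma(q',q''))$ (so that $\gamma_\nu+c_\nu T$ is an upper bound on the probability that trajectories of $S$ starting from $L^{-1}(\sigma(q,q'))$ reach $L^{-1}(\sigma(q',q''))$ within time horizon $\{0,\ldots,T\}$). Then the probability that the system satisfies $\neg\varphi$ is bounded by $$\mathbb{P}\{Trace_N(S)\models\neg\varphi\}\le\sum_{\mathbf q\in\mathcal{R}_{\le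 N+1}}\ \prod\left\{(\gamma_\nu+c_\nu T)\mid \nu=(q,q',q'',T)\in\mathcal{P}(\mathbf q)\right\}.$$
   Context: Systems. A discrete-time stochastic system is a tuple $S=(X,V_{\mathsf w},w,f)$, where $X$ and $V_{\mathsf w}$ are Borel spaces, $w=\{w(k):\Omega\to V_{\mathsf w},\ k\in\{0,1,2,\ldots\}\}$ is a sequence of i.i.d. random variables, and $f:X\times V_{\mathsf w}\to X$ is measurable. For a given initial state $x(0)\in X$, the state evolves as $x(k+1)=f(x(k),w(k))$. The solution process over $N$ time steps is $\mathbf{x}_N=x(0),x(1),\ldots,x(N-1)$, and its finite trace is $\sigma_{\mathbf{x}_N}=(\sigma_0,\ldots,\sigma_{N-1})\in\Pi^N$ with $\sigma_k=L(x(k))$. $Trace_N(S)$ denotes the set of traces of length $N$ of solution processes of $S$, and $\mathbb{P}\{Trace_N(S)\models\psi\}$ is the probability that the trace of length $N$ of the solution process (from its given initial state) satisfies $\psi$. For $c\ge0$, a function $B:X\to\mathbb{R}$ is a $c$-martingale for $S$ if $\mathbb{E}[B(x(k+1))\mid x(k)]\le B(x(k))+c$ for all $x(k)\in X$ and $k\ge 0$, the expectation being with respect to $w(k)$, i.e. $\mathbb{E}[B(f(x,w(k)))]\le B(x)+c$ for all $x\in X$. Logic. LTL$_F$ formulas over $\Pi$ are given by $\varphi::=\text{true}\mid p\mid\neg\varphi\mid\varphi_1\wedge\varphi_2\mid\varphi_1\vee\varphi_2\mid\bigcirc\varphi\mid\lozenge\varphi\mid\square\varphi\mid\varphi_1\mathcal{U}\varphi_2$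 with $p\in\Pi$. They are interpreted over finite non-empty words $\sigma=(\sigma_0,\ldots,\sigma_{|\sigma|-1})$ over the alphabet $\Pi$ (each letter $\sigma_i\in\Pi$ is the unique proposition true at step $i$). For $0\le i<|\sigma|$: $\sigma,i\models\text{true}$; $\sigma,i\models p$ iff $\sigma_i=p$; Boolean connectives are as usual; $\sigma,i\models\bigcirc\varphi$ iff $i<|\sigma|-1$ and $\sigma,i+1\models\varphi$; $\sigma,i\models\lozenge\varphi$ iff $\sigma,j\models\varphi$ for some $i\le j<|\sigma|$; $\sigma,i\models\square\varphi$ iff $\sigma,j\models\varphi$ for all $i\le j<|\sigma|$; $\sigma,i\models\varphi_1\mathcal{U}\varphi_2$ iff for some $i\le j<|\sigma|$, $\sigma,j\models\varphi_2$ and $\sigma,k\models\varphi_1$ for all $i\le k<j$. Write $\sigma\models\varphi$ iff $\sigma,0\models\varphi$. A formula is safe LTL$_F$ if it can be represented in positive normal form (negations only adjacent to atomic propositions) using only the temporal operators $\bigcirc$ and $\square$. Automata. A DFA is $\mathcal{A}=(Q,Q_0,\Sigma,\delta,F)$ with finite state set $Q$, initial states $Q_0\subseteq Q$, finite alphabet $\Sigma$, transition function $\delta:Q\times\Sigma\to Q$, accepting states $F\subseteq Q$. Write $q\overset{p}{\longrightarrow}q'$ if $\delta(q,p)=q'$. A word $(\sigma_0,\ldots,\sigma_{n-1})$ is accepted if there are $q_0\in Q_0$, $q_1,\ldots,q_n$ with $q_i\overset{\sigma_i}{\longrightarrow}q_{i+1}$ for $0\le i<n$ and $q_n\in F$.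 Decomposition. $Q_s:=\{q\in Q\mid \exists p\in\Pi,\ q\overset{p}{\longrightarrow}q\}$ is the set of states with self-loops. An accepting state run of $\mathcal{A}_{\neg\varphi}$ is a sequence $\mathbf q=(q_0,\ldots,q_n)\in Q^{n+1}$ with $q_0\in Q_0$, $q_n\in F$ such that there is a word $(\sigma_0,\ldots,\sigma_{n-1})\in\Pi^n$ with $q_i\overset{\sigma_i}{\longrightarrow}q_{i+1}$ for all $i<n$; its length is $|\mathbf q|=n+1$. Let $\mathcal{R}$ be the set of accepting state runs and $$\mathcal{R}_{\le N+1}:=\{\mathbf q=(q_0,\ldots,q_n)\in\mathcal{R}\mid n\le N,\ q_i\ne q_{i+1}\ \forall i<n\}.$$ For $\mathbf q=(q_0,\ldots,q_n)\in\mathcal{R}_{\le N+1}$, $$\mathcal{P}(\mathbf q):=\{(q_i,q_{i+1},q_{i+2},T(\mathbf q,q_{i+1}))\mid 0\le i\le n-2\},$$ where $T(\mathbf q,q_{i+1})=N+2-|\mathbf q|$ if $q_{i+1}\in Q_s$ and $T(\mathbf q,q_{i+1})=1$ otherwise. For states $q,q'$, $\sigma(q,q')\subseteq\Pi$ is the set of labels $p$ with $q\overset{p}{\longrightarrow}q'$. If $\mathcal{P}(\mathbf q)=\emptyset$, the product over it is the empty product, equal to $1$. *)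

theory Defs
  imports "HOL-Probability.Probability"
begin

section \<open>Borel spaces and stochastic systems\<close>

definition borel_sigma :: "'a topology \<Rightarrow> 'a measure" where
  "borel_sigma X = sigma (topspace X) {U. openin X U}"

text \<open>A Borel space is a topological space homeomorphic to a Borel subset of a Polish space.
  HOL cannot quantify over the carrier type of the Polish space. The type \<^typ>\<open>real\<close> only
  supplies points here, and \<^term>\<open>P\<close> is an arbitrary topology on a set of them; since Polish
  spaces have at most continuum many points, every Polish space has a copy of this form.\<close>

definition borel_space :: "'a topology \<Rightarrow> bool" where
  "borel_space X \<longleftrightarrow>
     (\<exists>(P :: real topology) E. completely_metrizable_space P \<and> separable_space P \<and>
        E \<in> sets (borel_sigma P) \<and> X homeomorphic_space subtopology P E)"

locale stochastic_system = prob_space M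
  for M :: "'o measure" +
  fixes X :: "'x topology" and V :: "'v topology"
    and w :: "nat \<Rightarrow> 'o \<Rightarrow> 'v" and f :: "'x \<times> 'v \<Rightarrow> 'x"
  assumes borel_X: "borel_space X"
    and borel_V: "borel_space V"
    and indep_w: "indep_vars (\<lambda>_. borel_sigma V) w UNIV"
    and ident_w: "\<And>k. distr M (borel_sigma V) (w k) = distr M (borel_sigma V) (w 0)"
    and measurable_f: "f \<in> borel_sigma X \<Otimes>\<^sub>M borel_sigma V \<rightarrow>\<^sub>M borel_sigma X"

primrec solution ::
  "(nat \<Rightarrow> 'o \<Rightarrow> 'v) \<Rightarrow> ('x \<times> 'v \<Rightarrow> 'x) \<Rightarrow> 'x \<Rightarrow> 'o \<Rightarrow> nat \<Rightarrow> 'x" where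
  "solution w f x0 \<omega> 0 = x0"
| "solution w f x0 \<omega> (Suc k) = f (solution w f x0 \<omega> k, w k \<omega>)"

definition sol_trace ::
  "(nat \<Rightarrow> 'o \<Rightarrow> 'v) \<Rightarrow> ('x \<times> 'v \<Rightarrow> 'x) \<Rightarrow> ('x \<Rightarrow> 'p) \<Rightarrow> 'x \<Rightarrow> nat \<Rightarrow> 'o \<Rightarrow> 'p list" where
  "sol_trace w f L x0 N \<omega> = map (\<lambda>k. L (solution w f x0 \<omega> k)) [0..<N]"

text \<open>Integrability is required explicitly because \<^const>\<open>lebesgue_integral\<close> is \<open>0\<close> on
  non-integrable functions.\<close>

definition c_martingale ::
  "'o measure \<Rightarrow> 'x topology \<Rightarrow> (nat \<Rightarrow> 'o \<Rightarrow> 'v) \<Rightarrow> ('x \<times> 'v \<Rightarrow> 'x) \<Rightarrow> real \<Rightarrow> ('x \<Rightarrow> real) \<Rightarrow> bool"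
where
  "c_martingale M X w f c B \<longleftrightarrow>
     (\<forall>x \<in> topspace X. \<forall>k. integrable M (\<lambda>\<omega>. B (f (x, w k \<omega>))) \<and>
        (LINT \<omega>|M. B (f (x, w k \<omega>))) \<le> B x + c)"

section \<open>Linear temporal logic over finite words\<close>

datatype 'p ltlf =
    LTrue
  | LAtom 'p
  | LNot "'p ltlf"
  | LAnd "'p ltlf" "'p ltlf"
  | LOr "'p ltlf" "'p ltlf"
  | LNext "'p ltlf"
  | LEventually "'p ltlf"
  | LAlways "'p ltlf"
  | LUntil "'p ltlf" "'p ltlf"

primrec sat_at :: "'p list \<Rightarrow> nat \<Rightarrow> 'p ltlf \<Rightarrow> bool" where
  "sat_at \<sigma> i LTrue \<longleftrightarrow> True"
| "sat_at \<sigma> i (LAtom p) \<longleftrightarrow> \<sigma> ! i = p"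
| "sat_at \<sigma> i (LNot \<phi>) \<longleftrightarrow> \<not> sat_at \<sigma> i \<phi>"
| "sat_at \<sigma> i (LAnd \<phi> \<psi>) \<longleftrightarrow> sat_at \<sigma> i \<phi> \<and> sat_at \<sigma> i \<psi>"
| "sat_at \<sigma> i (LOr \<phi> \<psi>) \<longleftrightarrow> sat_at \<sigma> i \<phi> \<or> sat_at \<sigma> i \<psi>"
| "sat_at \<sigma> i (LNext \<phi>) \<longleftrightarrow> i + 1 < length \<sigma> \<and> sat_at \<sigma> (i + 1) \<phi>"
| "sat_at \<sigma> i (LEventually \<phi>) \<longleftrightarrow> (\<exists>j. i \<le> j \<and> j < length \<sigma> \<and> sat_at \<sigma> j \<phi>)"
| "sat_at \<sigma> i (LAlways \<phi>) \<longleftrightarrow> (\<forall>j. i \<le> j \<and> j < length \<sigma> \<longrightarrow> sat_at \<sigma> j \<phi>)"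
| "sat_at \<sigma> i (LUntil \<phi> \<psi>) \<longleftrightarrow>
     (\<exists>j. i \<le> j \<and> j < length \<sigma> \<and> sat_at \<sigma> j \<psi> \<and> (\<forall>k. i \<le> k \<and> k < j \<longrightarrow> sat_at \<sigma> k \<phi>))"

text \<open>Meaningful for non-empty words only.\<close>

definition sat :: "'p list \<Rightarrow> 'p ltlf \<Rightarrow> bool" (infix \<open>\<Turnstile>\<^sub>F\<close> 50) where
  "\<sigma> \<Turnstile>\<^sub>F \<phi> \<longleftrightarrow> sat_at \<sigma> 0 \<phi>"

fun safe_pnf :: "'p ltlf \<Rightarrow> bool" where
  "safe_pnf LTrue \<longleftrightarrow> True"
| "safe_pnf (LAtom p) \<longleftrightarrow> True"
| "safe_pnf (LNot (LAtom p)) \<longleftrightarrow> True"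
| "safe_pnf (LAnd \<phi> \<psi>) \<longleftrightarrow> safe_pnf \<phi> \<and> safe_pnf \<psi>"
| "safe_pnf (LOr \<phi> \<psi>) \<longleftrightarrow> safe_pnf \<phi> \<and> safe_pnf \<psi>"
| "safe_pnf (LNext \<phi>) \<longleftrightarrow> safe_pnf \<phi>"
| "safe_pnf (LAlways \<phi>) \<longleftrightarrow> safe_pnf \<phi>"
| "safe_pnf _ \<longleftrightarrow> False"

definition safe_ltlf :: "'p set \<Rightarrow> 'p ltlf \<Rightarrow> bool" where
  "safe_ltlf AP \<phi> \<longleftrightarrow>
     (\<exists>\<psi>. safe_pnf \<psi> \<and> set_ltlf \<psi> \<subseteq> AP \<and>
        (\<forall>\<sigma> \<in> lists AP. \<sigma> \<noteq> [] \<longrightarrow> (\<sigma> \<Turnstile>\<^sub>F \<psi> \<longleftrightarrow> \<sigma> \<Turnstile>\<^sub>F \<phi>)))"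

section \<open>Automata and sequential decomposition\<close>

record ('q, 'p) dfa =
  states :: "'q set"
  initial :: "'q set"
  alphabet :: "'p set"
  delta :: "'q \<Rightarrow> 'p \<Rightarrow> 'q"
  final :: "'q set"

definition wf_dfa :: "('q, 'p) dfa \<Rightarrow> bool" where
  "wf_dfa A \<longleftrightarrow>
     finite (states A) \<and> initial A \<subseteq> states A \<and> finite (alphabet A) \<and> final A \<subseteq> states A \<and>
     (\<forall>q \<in> states A. \<forall>p \<in> alphabet A. delta A q p \<in> states A)"

definition run_on :: "('q, 'p) dfa \<Rightarrow> 'p list \<Rightarrow> 'q list \<Rightarrow> bool" where
  "run_on A \<sigma> qs \<longleftrightarrow>
     set qs \<subseteq> states A \<and> length qs = length \<sigma> + 1 \<and> hd qs \<in> initial A \<and> last qs \<in> final A \<and>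
     (\<forall>i < length \<sigma>. delta A (qs ! i) (\<sigma> ! i) = qs ! (i + 1))"

definition accepts :: "('q, 'p) dfa \<Rightarrow> 'p list \<Rightarrow> bool" where
  "accepts A \<sigma> \<longleftrightarrow> (\<exists>qs. run_on A \<sigma> qs)"

definition self_loop_states :: "('q, 'p) dfa \<Rightarrow> 'q set" where
  "self_loop_states A = {q \<in> states A. \<exists>p \<in> alphabet A. delta A q p = q}"

definition accepting_runs :: "('q, 'p) dfa \<Rightarrow> 'q list set" where
  "accepting_runs A = {qs. \<exists>\<sigma> \<in> lists (alphabet A). run_on A \<sigma> qs}"

definition accepting_runs_upto :: "('q, 'p) dfa \<Rightarrow> nat \<Rightarrow> 'q list set" where
  "accepting_runs_upto A N =
     {qs \<in> accepting_runs A. length qs \<le> N + 1 \<and>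
        (\<forall>i. i + 1 < length qs \<longrightarrow> qs ! i \<noteq> qs ! (i + 1))}"

text \<open>The subtraction does not truncate on runs of length at most \<open>N + 1\<close>.\<close>

definition horizon :: "('q, 'p) dfa \<Rightarrow> nat \<Rightarrow> 'q list \<Rightarrow> 'q \<Rightarrow> nat" where
  "horizon A N qs q = (if q \<in> self_loop_states A then N + 2 - length qs else 1)"

definition triples :: "('q, 'p) dfa \<Rightarrow> nat \<Rightarrow> 'q list \<Rightarrow> ('q \<times> 'q \<times> 'q \<times> nat) set" where
  "triples A N qs =
     {(qs ! i, qs ! (i + 1), qs ! (i + 2), horizon A N qs (qs ! (i + 1))) | i. i + 2 < length qs}"

definition labels :: "('q, 'p) dfa \<Rightarrow> 'q \<Rightarrow> 'q \<Rightarrow> 'p set" where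
  "labels A q q' = {p \<in> alphabet A. delta A q p = q'}"

end

theory Submission
  imports Defs
begin

text \<open>Delete the repeated states from the automaton run on the trace. The bad event is then a finite
  union, over the runs in \<open>accepting_runs_upto\<close>, of the events that the destuttered run of the trace
  equals a given \<open>qs\<close>. The probability of such an event is computed by backward recursion (the
  Markov property), and bounded stage by stage from the end of \<open>qs\<close>: if, once the state \<open>qs ! (i + 2)\<close>
  is entered, the remainder has probability at most \<open>C\<close>, then while the run waits in
  \<open>qs ! (i + 1)\<close> with at most \<open>t\<close> self-loops to spare, the conditional probability is at most
  \<open>C * (B x + c * t)\<close>, because \<open>B\<close> is a \<open>c\<close>-martingale with \<open>B \<ge> 1\<close> on leaving. On entering
  \<open>qs ! (i + 1)\<close> one has \<open>B \<le> \<gamma>\<close>, which costs the factor \<open>\<gamma> + c * T\<close>. Every factor may be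
  cut off at \<open>1\<close>, so counting a repeated triple only once does no harm.\<close>

section \<open>Destuttered runs\<close>

text \<open>Repetitions are dropped while the word is read, not from the finished run, so that
  reading further letters only extends the list.\<close>

definition destutter_step :: "('q \<Rightarrow> 'p \<Rightarrow> 'q) \<Rightarrow> 'q list \<Rightarrow> 'p \<Rightarrow> 'q list" where
  "destutter_step d qs p = (if d (last qs) p = last qs then qs else qs @ [d (last qs) p])"

definition destutter :: "('q \<Rightarrow> 'p \<Rightarrow> 'q) \<Rightarrow> 'q \<Rightarrow> 'p list \<Rightarrow> 'q list" where
  "destutter d q \<sigma> = foldl (destutter_step d) [q] \<sigma>"

lemma destutter_Nil [simp]: "destutter d q [] = [q]"
  by (simp add: destutter_def)

lemma destutter_snoc [simp]: "destutter d q (\<sigma> @ [p]) = destutter_step d (destutter d q \<sigma>) p"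
  by (simp add: destutter_def)

lemma destutter_ne [simp]: "destutter d q \<sigma> \<noteq> []"
  by (induction \<sigma> rule: rev_induct) (auto simp: destutter_step_def)

lemma hd_destutter [simp]: "hd (destutter d q \<sigma>) = q"
  by (induction \<sigma> rule: rev_induct) (auto simp: destutter_step_def)

lemma last_destutter: "last (destutter d q \<sigma>) = foldl d q \<sigma>"
  by (induction \<sigma> rule: rev_induct) (auto simp: destutter_step_def)

lemma length_destutter: "length (destutter d q \<sigma>) \<le> length \<sigma> + 1"
  by (induction \<sigma> rule: rev_induct) (auto simp: destutter_step_def)

text \<open>Each letter appends at most one state and removes none. This later rules out completions
  that are too short or have already deviated from the target run.\<close>

lemma destutter_append:
  "\<exists>zs. destutter d q (\<sigma> @ \<tau>) = destutter d q \<sigma> @ zs \<and> length zs \<le> length \<tau>"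
proof (induction \<tau> rule: rev_induct)
  case (snoc p \<tau>)
  then obtain zs where "destutter d q (\<sigma> @ \<tau>) = destutter d q \<sigma> @ zs" "length zs \<le> length \<tau>"
    by auto
  then show ?case
    unfolding append_assoc[symmetric] destutter_snoc
    by (auto simp: destutter_step_def simp del: last_append)
qed simp

lemma destutter_distinct_adj:
  "i + 1 < length (destutter d q \<sigma>) \<Longrightarrow> destutter d q \<sigma> ! i \<noteq> destutter d q \<sigma> ! (i + 1)"
proof (induction \<sigma> rule: rev_induct)
  case Nil
  then show ?case by simp
next
  case (snoc p \<sigma>)
  let ?r = "destutter d q \<sigma>"
  have last: "last ?r = ?r ! (length ?r - 1)" by (simp add: last_conv_nth)
  show ?case
  proof (cases "i + 1 < length ?r")
    case True
    then show ?thesis using snoc.IH by (simp add: destutter_step_def nth_append)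
  next
    case False
    with snoc.prems have new: "d (last ?r) p \<noteq> last ?r" and "i + 1 = length ?r"
      by (simp_all add: destutter_step_def split: if_splits)
    then have "i < length ?r" "i = length ?r - 1" by simp_all
    with last new \<open>i + 1 = length ?r\<close> show ?thesis
      by (simp add: destutter_step_def nth_append)
  qed
qed

lemma set_destutter:
  "q \<in> Q \<Longrightarrow> \<sigma> \<in> lists P \<Longrightarrow> (\<And>q p. q \<in> Q \<Longrightarrow> p \<in> P \<Longrightarrow> d q p \<in> Q) \<Longrightarrow> set (destutter d q \<sigma>) \<subseteq> Q"
proof (induction \<sigma> rule: rev_induct)
  case (snoc p \<sigma>)
  then have "last (destutter d q \<sigma>) \<in> Q" using last_in_set[OF destutter_ne] by fastforce
  with snoc show ?case by (auto simp: destutter_step_def)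
qed simp

text \<open>Membership in \<open>accepting_runs\<close> asks for a word that drives the shortened
  run. Keeping exactly the letters that changed the state provides it.\<close>

lemma destutter_word:
  assumes "\<sigma> \<in> lists P"
  shows "\<exists>\<tau> \<in> lists P. length (destutter d q \<sigma>) = length \<tau> + 1 \<and>
    (\<forall>i < length \<tau>. d (destutter d q \<sigma> ! i) (\<tau> ! i) = destutter d q \<sigma> ! (i + 1))"
  using assms
proof (induction \<sigma> rule: rev_induct)
  case Nil
  then show ?case by (intro bexI[of _ "[]"]) auto
next
  case (snoc p \<sigma>)
  then obtain \<tau> where \<tau>: "\<tau> \<in> lists P" "length (destutter d q \<sigma>) = length \<tau> + 1"
    "\<forall>i < length \<tau>. d (destutter d q \<sigma> ! i) (\<tau> ! i) = destutter d q \<sigma> ! (i + 1)"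
    by auto
  show ?case
  proof (cases "d (last (destutter d q \<sigma>)) p = last (destutter d q \<sigma>)")
    case True
    with \<tau> show ?thesis by (intro bexI[of _ \<tau>]) (auto simp: destutter_step_def)
  next
    case False
    have "last (destutter d q \<sigma>) = destutter d q \<sigma> ! length \<tau>"
      using \<tau>(2) by (simp add: last_conv_nth)
    with False \<tau> snoc.prems show ?thesis
      by (intro bexI[of _ "\<tau> @ [p]"]) (auto simp: destutter_step_def nth_append less_Suc_eq)
  qed
qed

lemma run_on_last:
  assumes "run_on A \<sigma> qs"
  shows "foldl (delta A) (hd qs) \<sigma> = last qs"
proof -
  from assms have qs: "length qs = length \<sigma> + 1" "qs \<noteq> []"
    "\<forall>i < length \<sigma>. delta A (qs ! i) (\<sigma> ! i) = qs ! (i + 1)"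
    by (auto simp: run_on_def)
  have "k \<le> length \<sigma> \<Longrightarrow> foldl (delta A) (hd qs) (take k \<sigma>) = qs ! k" for k
    using qs by (induction k) (auto simp: hd_conv_nth take_Suc_conv_app_nth)
  from this[of "length \<sigma>"] qs show ?thesis by (simp add: last_conv_nth)
qed

text \<open>Destuttering keeps the first and the last state, hence acceptance, and its length is at
  most that of the original run.\<close>

lemma destutter_run_on:
  assumes "wf_dfa A" "\<sigma> \<in> lists (alphabet A)" "run_on A \<sigma> qs"
  shows "destutter (delta A) (hd qs) \<sigma> \<in> accepting_runs_upto A (length \<sigma>)"
proof -
  let ?r = "destutter (delta A) (hd qs) \<sigma>"
  obtain \<tau> where \<tau>: "\<tau> \<in> lists (alphabet A)" "length ?r = length \<tau> + 1"
    "\<forall>i < length \<tau>. delta A (?r ! i) (\<tau> ! i) = ?r ! (i + 1)"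
    using destutter_word[OF assms(2), of "delta A" "hd qs"] by auto
  have "set ?r \<subseteq> states A"
    using assms by (intro set_destutter[where P = "alphabet A"]) (auto simp: wf_dfa_def run_on_def)
  with \<tau> assms(3) have "run_on A \<tau> ?r"
    using run_on_last[OF assms(3)] by (auto simp: run_on_def last_destutter)
  with \<tau>(1) show ?thesis
    using length_destutter[of "delta A" "hd qs" \<sigma>] destutter_distinct_adj[of _ "delta A" "hd qs" \<sigma>]
    by (auto simp: accepting_runs_upto_def accepting_runs_def)
qed

lemma finite_accepting_runs_upto: "wf_dfa A \<Longrightarrow> finite (accepting_runs_upto A N)"
  by (rule finite_subset[OF _ finite_lists_length_le[of "states A" "N + 1"]])
    (auto simp: accepting_runs_upto_def accepting_runs_def run_on_def wf_dfa_def)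

text \<open>\<open>\<nu>\<close> need not be injective, so the left product may count a value
  several times. A first occurrence is bounded by \<open>b\<close>, a repetition by 1.\<close>

lemma prod_min_one_le_prod_image:
  fixes b :: "'b \<Rightarrow> real"
  assumes "finite I" and "\<And>y. y \<in> \<nu> ` I \<Longrightarrow> 0 \<le> b y"
  shows "(\<Prod>i\<in>I. min 1 (b (\<nu> i))) \<le> (\<Prod>y\<in>\<nu> ` I. b y)"
  using assms
proof (induction I rule: finite_induct)
  case (insert i I)
  have nonneg: "0 \<le> (\<Prod>k\<in>I. min 1 (b (\<nu> k)))"
    using insert.prems by (intro prod_nonneg) auto
  have IH: "(\<Prod>k\<in>I. min 1 (b (\<nu> k))) \<le> (\<Prod>y\<in>\<nu> ` I. b y)"
    using insert by auto
  show ?case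
  proof (cases "\<nu> i \<in> \<nu> ` I")
    case True
    have "min 1 (b (\<nu> i)) * (\<Prod>k\<in>I. min 1 (b (\<nu> k))) \<le> 1 * (\<Prod>k\<in>I. min 1 (b (\<nu> k)))"
      by (intro mult_right_mono nonneg) auto
    with IH True insert.hyps show ?thesis by (simp add: insert_absorb)
  next
    case False
    have "min 1 (b (\<nu> i)) * (\<Prod>k\<in>I. min 1 (b (\<nu> k))) \<le> b (\<nu> i) * (\<Prod>y\<in>\<nu> ` I. b y)"
      using insert.prems by (intro mult_mono IH nonneg) auto
    with False insert.hyps show ?thesis by simp
  qed
qed simp

section \<open>Conditional probabilities of trace properties\<close>

locale labelled_system = stochastic_system M X V w f
  for M :: "'o measure" and X :: "'x topology" and V :: "'v topology"
    and w :: "nat \<Rightarrow> 'o \<Rightarrow> 'v" and f :: "'x \<times> 'v \<Rightarrow> 'x" +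
  fixes AP :: "'p set" and L :: "'x \<Rightarrow> 'p"
  assumes finite_AP: "finite AP"
    and measurable_L: "L \<in> borel_sigma X \<rightarrow>\<^sub>M count_space AP"
begin

abbreviation noise :: "'v measure" where
  "noise \<equiv> distr M (borel_sigma V) (w 0)"

lemma space_borel_X: "space (borel_sigma X) = topspace X"
  by (simp add: borel_sigma_def space_measure_of_conv)

lemma L_in_AP: "x \<in> topspace X \<Longrightarrow> L x \<in> AP"
  using measurable_space[OF measurable_L] by (simp add: space_borel_X)

lemma measurable_w: "w k \<in> M \<rightarrow>\<^sub>M borel_sigma V"
  using indep_w unfolding indep_vars_def by auto

sublocale noise: prob_space noise
  by (rule prob_space_distr[OF measurable_w])

lemma measurable_f_noise: "f \<in> borel_sigma X \<Otimes>\<^sub>M noise \<rightarrow>\<^sub>M borel_sigma X"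
  using measurable_f by (simp cong: measurable_cong_sets sets_pair_measure_cong)

lemma f_in_space: "x \<in> topspace X \<Longrightarrow> v \<in> space noise \<Longrightarrow> f (x, v) \<in> topspace X"
  using measurable_space[OF measurable_f_noise, of "(x, v)"]
  by (simp add: space_pair_measure space_borel_X)

lemma measurable_f_section:
  "x \<in> topspace X \<Longrightarrow> (\<lambda>v. f (x, v)) \<in> noise \<rightarrow>\<^sub>M borel_sigma X"
  by (rule measurable_compose[OF measurable_Pair1' measurable_f_noise]) (simp add: space_borel_X)

section \<open>Measurability of solutions and traces\<close>

lemma countable_words: "countable (lists AP)"
  using finite_AP by (intro countable_lists countable_finite)

text \<open>The noise sequence is arbitrary because the lemma serves both for \<open>w\<close> on
  \<open>M\<close> and for the coordinate maps on the product space of past noises.\<close>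

lemma measurable_solution:
  assumes "\<And>i. i < k \<Longrightarrow> Y i \<in> R \<rightarrow>\<^sub>M borel_sigma V" and "x0 \<in> topspace X"
  shows "(\<lambda>\<omega>. solution Y f x0 \<omega> k) \<in> R \<rightarrow>\<^sub>M borel_sigma X"
  using assms(1)
proof (induction k)
  case 0
  then show ?case using assms(2) by (simp add: space_borel_X)
next
  case (Suc k)
  then show ?case
    by (auto intro!: measurable_compose[OF _ measurable_f] measurable_Pair)
qed

lemma sol_trace_Suc:
  "sol_trace Y f L x0 (Suc k) \<omega> = sol_trace Y f L x0 k \<omega> @ [L (solution Y f x0 \<omega> k)]"
  by (simp add: sol_trace_def)

text \<open>The last of \<open>k\<close> letters depends on the first \<open>k - 1\<close> noises
  only, hence the premise for \<open>i + 1 < k\<close>.\<close>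

lemma measurable_sol_trace:
  assumes "\<And>i. i + 1 < k \<Longrightarrow> Y i \<in> R \<rightarrow>\<^sub>M borel_sigma V" and "x0 \<in> topspace X"
  shows "sol_trace Y f L x0 k \<in> R \<rightarrow>\<^sub>M count_space (lists AP)"
  using assms(1)
proof (induction k)
  case 0
  then show ?case by (simp add: sol_trace_def[abs_def])
next
  case (Suc k)
  have label: "(\<lambda>\<omega>. L (solution Y f x0 \<omega> k)) \<in> R \<rightarrow>\<^sub>M count_space AP"
    using Suc.prems assms(2)
    by (intro measurable_compose[OF measurable_solution measurable_L]) auto
  have word: "sol_trace Y f L x0 k \<in> R \<rightarrow>\<^sub>M count_space (lists AP)"
    using Suc by auto
  have "(\<lambda>\<omega>. sol_trace Y f L x0 k \<omega> @ [L (solution Y f x0 \<omega> k)])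
      \<in> R \<rightarrow>\<^sub>M count_space (lists AP)"
  \<comment> \<open>With the last letter fixed to one of finitely many values, appending it is a map
    between discrete spaces.\<close>
  proof (rule measurable_compose_countable'[OF _ label countable_finite[OF finite_AP]])
    fix p assume "p \<in> AP"
    then show "(\<lambda>\<omega>. sol_trace Y f L x0 k \<omega> @ [p]) \<in> R \<rightarrow>\<^sub>M count_space (lists AP)"
      by (intro measurable_compose[OF word]) auto
  qed
  then show ?case by (simp add: sol_trace_Suc[abs_def])
qed

text \<open>The conditional probability that the completed trace satisfies \<open>\<Phi>\<close>, given the word
  \<open>\<sigma>\<close> read so far, the state \<open>x\<close> whose label comes next, and \<open>m\<close> letters still to be read.\<close>

primrec word_prob :: "('p list \<Rightarrow> bool) \<Rightarrow> nat \<Rightarrow> 'p list \<Rightarrow> 'x \<Rightarrow> ennreal" where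
  "word_prob \<Phi> 0 \<sigma> x = of_bool (\<Phi> \<sigma>)"
| "word_prob \<Phi> (Suc m) \<sigma> x = (\<integral>\<^sup>+v. word_prob \<Phi> m (\<sigma> @ [L x]) (f (x, v)) \<partial>noise)"

lemma measurable_word_prob:
  "\<sigma> \<in> lists AP \<Longrightarrow> word_prob \<Phi> m \<sigma> \<in> borel_measurable (borel_sigma X)"
proof (induction m arbitrary: \<sigma>)
  case 0
  then show ?case by simp
next
  case (Suc m)
  have "(\<lambda>x. \<integral>\<^sup>+v. word_prob \<Phi> m (\<sigma> @ [L x]) (f (x, v)) \<partial>noise) \<in> borel_measurable (borel_sigma X)"
  proof (rule measurable_compose_countable'[OF _ measurable_L countable_finite[OF finite_AP]])
    fix p assume "p \<in> AP"
    then have "word_prob \<Phi> m (\<sigma> @ [p]) \<in> borel_measurable (borel_sigma X)"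
      using Suc by simp
    from measurable_compose[OF measurable_f_noise this]
    show "(\<lambda>x. \<integral>\<^sup>+v. word_prob \<Phi> m (\<sigma> @ [p]) (f (x, v)) \<partial>noise) \<in> borel_measurable (borel_sigma X)"
      by (intro noise.borel_measurable_nn_integral) (simp add: case_prod_unfold)
  qed
  then show ?case by simp
qed

section \<open>The Markov property and the law of the trace\<close>

lemma solution_cong:
  "(\<And>i. i < k \<Longrightarrow> Y i \<omega> = Z i \<omega>') \<Longrightarrow> solution Y f x0 \<omega> k = solution Z f x0 \<omega>' k"
  by (induction k) auto

lemma sol_trace_cong:
  "(\<And>i. i < k \<Longrightarrow> Y i \<omega> = Z i \<omega>') \<Longrightarrow> sol_trace Y f L x0 (Suc k) \<omega> = sol_trace Z f L x0 (Suc k) \<omega>'"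
  by (auto simp: sol_trace_def simp del: upt_Suc intro!: arg_cong[where f = L] solution_cong)

text \<open>The index blocks \<open>{..<k}\<close> and \<open>{k}\<close> are disjoint, so the
  restricted families are independent and their joint law is a product. The singleton block is then
  replaced by its only coordinate, whose law is \<open>noise\<close> since all \<open>w k\<close>
  are identically distributed.\<close>

lemma distr_past_noise:
  "distr M (PiM {..<k} (\<lambda>_. borel_sigma V) \<Otimes>\<^sub>M borel_sigma V) (\<lambda>\<omega>. (\<lambda>i\<in>{..<k}. w i \<omega>, w k \<omega>)) =
    distr M (PiM {..<k} (\<lambda>_. borel_sigma V)) (\<lambda>\<omega>. \<lambda>i\<in>{..<k}. w i \<omega>) \<Otimes>\<^sub>M noise"
proof -
  let ?Q = "PiM {..<k} (\<lambda>_. borel_sigma V)" and ?Y = "\<lambda>\<omega>. \<lambda>i\<in>{..<k}. w i \<omega>"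
  let ?R = "PiM {k} (\<lambda>_. borel_sigma V)" and ?Z = "\<lambda>\<omega>. \<lambda>i\<in>{k}. w i \<omega>"
  have Y: "?Y \<in> M \<rightarrow>\<^sub>M ?Q" and Z: "?Z \<in> M \<rightarrow>\<^sub>M ?R"
    by (intro measurable_restrict measurable_w)+
  have proj: "(\<lambda>y. y k) \<in> ?R \<rightarrow>\<^sub>M borel_sigma V"
    by (intro measurable_component_singleton) simp
  have "indep_var ?Q ?Y ?R ?Z"
    by (intro indep_var_restrict[OF indep_w]) auto
  then have joint: "distr M ?Q ?Y \<Otimes>\<^sub>M distr M ?R ?Z = distr M (?Q \<Otimes>\<^sub>M ?R) (\<lambda>\<omega>. (?Y \<omega>, ?Z \<omega>))"
    by (simp add: indep_var_distribution_eq)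
  have proj_Z: "distr (distr M ?R ?Z) (borel_sigma V) (\<lambda>y. y k) = noise"
    by (simp add: distr_distr[OF proj Z] comp_def ident_w[of k])
  have "distr M ?Q ?Y \<Otimes>\<^sub>M noise =
      distr (distr M ?Q ?Y) ?Q (\<lambda>y. y) \<Otimes>\<^sub>M distr (distr M ?R ?Z) (borel_sigma V) (\<lambda>y. y k)"
    unfolding proj_Z by (simp add: distr_id2)
  also have "\<dots> = distr (distr M ?Q ?Y \<Otimes>\<^sub>M distr M ?R ?Z) (?Q \<Otimes>\<^sub>M borel_sigma V) (\<lambda>(x, y). (x, y k))"
    using proj by (intro pair_measure_distr) (auto simp: proj_Z noise.sigma_finite_measure_axioms)
  also have "\<dots> = distr M (?Q \<Otimes>\<^sub>M borel_sigma V) (\<lambda>\<omega>. (?Y \<omega>, w k \<omega>))"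
    unfolding joint
    by (subst distr_distr) (auto simp: comp_def case_prod_unfold intro!: measurable_Pair Y Z
        measurable_compose[OF measurable_snd proj])
  finally show ?thesis by simp
qed

text \<open>The first \<open>k + 1\<close> letters and the state at time \<open>k\<close> are
  functions of the noises before \<open>k\<close>, and \<open>w k\<close> is independent of these.
  Integrating \<open>w k\<close> out first (Tonelli) unfolds one level of
  \<open>word_prob\<close>.\<close>

lemma word_prob_step:
  assumes "x0 \<in> topspace X"
  shows "(\<integral>\<^sup>+\<omega>. word_prob \<Phi> (Suc m) (sol_trace w f L x0 k \<omega>) (solution w f x0 \<omega> k) \<partial>M) =
    (\<integral>\<^sup>+\<omega>. word_prob \<Phi> m (sol_trace w f L x0 (Suc k) \<omega>) (solution w f x0 \<omega> (Suc k)) \<partial>M)"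
proof -
  let ?Q = "PiM {..<k} (\<lambda>_. borel_sigma V)" and ?Y = "\<lambda>\<omega>. \<lambda>i\<in>{..<k}. w i \<omega>"
  define g where "g = (\<lambda>(y, v). word_prob \<Phi> m (sol_trace (\<lambda>i y. y i) f L x0 (Suc k) y)
      (f (solution (\<lambda>i y. y i) f x0 y k, v)))"
  have proj: "(\<lambda>y. y i) \<in> ?Q \<rightarrow>\<^sub>M borel_sigma V" if "i < k" for i
    using that by (intro measurable_component_singleton) auto
  have word: "sol_trace (\<lambda>i y. y i) f L x0 (Suc k) \<in> ?Q \<rightarrow>\<^sub>M count_space (lists AP)"
    by (intro measurable_sol_trace proj assms) simp
  have next_state: "(\<lambda>z. f (solution (\<lambda>i y. y i) f x0 (fst z) k, snd z))
      \<in> ?Q \<Otimes>\<^sub>M borel_sigma V \<rightarrow>\<^sub>M borel_sigma X"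
    by (intro measurable_compose[OF _ measurable_f] measurable_Pair
        measurable_compose[OF measurable_fst measurable_solution] proj assms measurable_snd)
  have g: "g \<in> borel_measurable (?Q \<Otimes>\<^sub>M borel_sigma V)"
    unfolding g_def case_prod_unfold
    by (rule measurable_compose_countable'[OF _ measurable_compose[OF measurable_fst word] countable_words])
      (rule measurable_compose[OF next_state measurable_word_prob])
  have g': "g \<in> borel_measurable (?Q \<Otimes>\<^sub>M noise)"
    using g by (simp cong: measurable_cong_sets sets_pair_measure_cong)
  have Y: "?Y \<in> M \<rightarrow>\<^sub>M ?Q"
    by (intro measurable_restrict measurable_w)
  interpret Y: prob_space "distr M ?Q ?Y"
    by (rule prob_space_distr[OF Y])
  have past: "solution (\<lambda>i y. y i) f x0 (?Y \<omega>) k = solution w f x0 \<omega> k"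
    "sol_trace (\<lambda>i y. y i) f L x0 (Suc k) (?Y \<omega>) = sol_trace w f L x0 (Suc k) \<omega>" for \<omega>
    by (intro solution_cong sol_trace_cong; simp)+
  have "(\<integral>\<^sup>+\<omega>. word_prob \<Phi> m (sol_trace w f L x0 (Suc k) \<omega>) (solution w f x0 \<omega> (Suc k)) \<partial>M)
      = (\<integral>\<^sup>+\<omega>. g (?Y \<omega>, w k \<omega>) \<partial>M)"
    by (simp add: g_def past)
  also have "\<dots> = (\<integral>\<^sup>+z. g z \<partial>distr M (?Q \<Otimes>\<^sub>M borel_sigma V) (\<lambda>\<omega>. (?Y \<omega>, w k \<omega>)))"
    using g by (intro nn_integral_distr[symmetric] measurable_Pair Y measurable_w) simp
  also have "distr M (?Q \<Otimes>\<^sub>M borel_sigma V) (\<lambda>\<omega>. (?Y \<omega>, w k \<omega>)) = distr M ?Q ?Y \<Otimes>\<^sub>M noise"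
    by (rule distr_past_noise)
  also have "(\<integral>\<^sup>+z. g z \<partial>(distr M ?Q ?Y \<Otimes>\<^sub>M noise)) = (\<integral>\<^sup>+y. \<integral>\<^sup>+v. g (y, v) \<partial>noise \<partial>distr M ?Q ?Y)"
    using g by (intro noise.nn_integral_fst[symmetric])
      (simp cong: measurable_cong_sets sets_pair_measure_cong)
  also have "\<dots> = (\<integral>\<^sup>+\<omega>. \<integral>\<^sup>+v. g (?Y \<omega>, v) \<partial>noise \<partial>M)"
    using g' by (intro nn_integral_distr[OF Y] noise.borel_measurable_nn_integral) simp
  also have "\<dots> = (\<integral>\<^sup>+\<omega>. word_prob \<Phi> (Suc m) (sol_trace w f L x0 k \<omega>) (solution w f x0 \<omega> k) \<partial>M)"
    by (simp add: g_def past flip: sol_trace_Suc)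
  finally show ?thesis by simp
qed

lemma emeasure_sol_trace:
  assumes "x0 \<in> topspace X"
  shows "emeasure M {\<omega> \<in> space M. \<Phi> (sol_trace w f L x0 N \<omega>)} = word_prob \<Phi> N [] x0"
proof -
  let ?E = "{\<omega> \<in> space M. \<Phi> (sol_trace w f L x0 N \<omega>)}"
  \<comment> \<open>The value depends on \<open>k + m\<close> only: \<open>m = 0\<close> gives the
    probability of the event, \<open>k = 0\<close> the recursion started at
    \<open>x0\<close>.\<close>
  have expand: "(\<integral>\<^sup>+\<omega>. word_prob \<Phi> m (sol_trace w f L x0 k \<omega>) (solution w f x0 \<omega> k) \<partial>M)
      = word_prob \<Phi> (k + m) [] x0" for k m
  proof (induction k arbitrary: m)
    case 0
    then show ?case by (simp add: sol_trace_def emeasure_space_1)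
  next
    case (Suc k)
    then show ?case using word_prob_step[OF assms, of \<Phi> m k] Suc[of "Suc m"]
      by (metis add_Suc_shift)
  qed
  have trace: "sol_trace w f L x0 N \<in> M \<rightarrow>\<^sub>M count_space (lists AP)"
    by (intro measurable_sol_trace measurable_w assms)
  have "?E = sol_trace w f L x0 N -` {\<sigma> \<in> lists AP. \<Phi> \<sigma>} \<inter> space M"
    using measurable_space[OF trace] by auto
  then have "?E \<in> sets M"
    using measurable_sets[OF trace, of "{\<sigma> \<in> lists AP. \<Phi> \<sigma>}"] by auto
  then have "emeasure M ?E = (\<integral>\<^sup>+\<omega>. indicator ?E \<omega> \<partial>M)"
    by simp
  also have "\<dots> = (\<integral>\<^sup>+\<omega>. of_bool (\<Phi> (sol_trace w f L x0 N \<omega>)) \<partial>M)"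
    by (intro nn_integral_cong) (simp add: indicator_def)
  also have "\<dots> = word_prob \<Phi> N [] x0"
    using expand[of 0 N] by simp
  finally show ?thesis .
qed

section \<open>Bounds on conditional probabilities and one-step inequalities\<close>

lemma word_prob_le_1: "word_prob \<Phi> m \<sigma> x \<le> 1"
proof (induction m arbitrary: \<sigma> x)
  case (Suc m)
  have "(\<integral>\<^sup>+v. word_prob \<Phi> m (\<sigma> @ [L x]) (f (x, v)) \<partial>noise) \<le> (\<integral>\<^sup>+v. 1 \<partial>noise)"
    by (intro nn_integral_mono Suc)
  then show ?case by (simp add: noise.emeasure_space_1 del: nn_integral_distr space_distr)
qed (simp add: of_bool_def)

lemma word_prob_eq_0:
  assumes "\<And>\<tau>. length \<tau> = m \<Longrightarrow> \<not> \<Phi> (\<sigma> @ \<tau>)"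
  shows "word_prob \<Phi> m \<sigma> x = 0"
  using assms
proof (induction m arbitrary: \<sigma> x)
  case (Suc m)
  then have "word_prob \<Phi> m (\<sigma> @ [L x]) y = 0" for y by simp
  then show ?case by simp
qed (auto dest: spec[of _ "[]"])

lemma nn_integral_noise_le_const:
  assumes "x \<in> topspace X" and "\<And>y. y \<in> topspace X \<Longrightarrow> u y \<le> ennreal C"
  shows "(\<integral>\<^sup>+v. u (f (x, v)) \<partial>noise) \<le> ennreal C"
proof -
  have "(\<integral>\<^sup>+v. u (f (x, v)) \<partial>noise) \<le> (\<integral>\<^sup>+v. ennreal C \<partial>noise)"
    using assms f_in_space by (intro nn_integral_mono) blast
  also have "\<dots> = ennreal C"
    using noise.emeasure_space_1 by simp
  finally show ?thesis .
qed

text \<open>One step of the dynamics raises an affine bound in \<open>B\<close> by at most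
  \<open>c\<close>; \<open>k\<close> carries the increments of the steps that follow. Integrability
  identifies the nonnegative integral with the Bochner integral of the martingale condition.\<close>

lemma nn_integral_noise_le_barrier:
  assumes "c_martingale M X w f c B" and "B \<in> borel_measurable (borel_sigma X)"
    and "\<And>y. y \<in> topspace X \<Longrightarrow> 0 \<le> B y" and "x \<in> topspace X" and "0 \<le> C" "0 \<le> k"
    and "\<And>y. y \<in> topspace X \<Longrightarrow> u y \<le> ennreal (C * (B y + k))"
  shows "(\<integral>\<^sup>+v. u (f (x, v)) \<partial>noise) \<le> ennreal (C * (B x + c + k))"
proof -
  have meas: "(\<lambda>v. B (f (x, v))) \<in> borel_measurable (borel_sigma V)"
    using measurable_compose[OF measurable_f_section[OF assms(4)] assms(2)] by simp
  have mart: "integrable M (\<lambda>\<omega>. B (f (x, w 0 \<omega>)))" "(LINT \<omega>|M. B (f (x, w 0 \<omega>))) \<le> B x + c"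
    using assms(1,4) by (auto simp: c_martingale_def)
  have int: "integrable noise (\<lambda>v. B (f (x, v)))"
    using mart(1) integrable_distr_eq[OF measurable_w meas] by simp
  have le: "(\<integral>v. B (f (x, v)) \<partial>noise) \<le> B x + c"
    using mart(2) integral_distr[OF measurable_w meas] by simp
  have "(\<integral>\<^sup>+v. u (f (x, v)) \<partial>noise) \<le> (\<integral>\<^sup>+v. ennreal (C * (B (f (x, v)) + k)) \<partial>noise)"
    using assms(7) f_in_space[OF assms(4)] by (intro nn_integral_mono) blast
  also have "\<dots> = ennreal (\<integral>v. C * (B (f (x, v)) + k) \<partial>noise)"
    using assms(3,5,6) f_in_space[OF assms(4)]
    by (intro nn_integral_eq_integral AE_I2 integrable_mult_right Bochner_Integration.integrable_add int) auto
  also have "(\<integral>v. C * (B (f (x, v)) + k) \<partial>noise) = C * ((\<integral>v. B (f (x, v)) \<partial>noise) + k)"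
    using int noise.prob_space by simp
  also have "ennreal (C * ((\<integral>v. B (f (x, v)) \<partial>noise) + k)) \<le> ennreal (C * (B x + c + k))"
    using le assms(5) by (intro ennreal_leI mult_left_mono) auto
  finally show ?thesis .
qed

end

section \<open>Barrier bounds along a destuttered run\<close>

locale labelled_system_run = labelled_system M X V w f AP L
  for M :: "'o measure" and X :: "'x topology" and V :: "'v topology"
    and w :: "nat \<Rightarrow> 'o \<Rightarrow> 'v" and f :: "'x \<times> 'v \<Rightarrow> 'x" and AP :: "'p set" and L :: "'x \<Rightarrow> 'p" +
  fixes A :: "('q, 'p) dfa" and N :: nat and qs :: "'q list"
  assumes alphabet_A: "alphabet A = AP"
    and qs_run: "qs \<in> accepting_runs_upto A N"
begin

abbreviation visited :: "'p list \<Rightarrow> 'q list" where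
  "visited \<equiv> destutter (delta A) (hd qs)"

abbreviation run_prob :: "nat \<Rightarrow> 'p list \<Rightarrow> 'x \<Rightarrow> ennreal" where
  "run_prob \<equiv> word_prob (\<lambda>\<sigma>. visited \<sigma> = qs)"

lemma length_qs: "length qs \<le> N + 1"
  using qs_run by (simp add: accepting_runs_upto_def)

lemma qs_in_states: "i < length qs \<Longrightarrow> qs ! i \<in> states A"
  using qs_run by (auto simp: accepting_runs_upto_def accepting_runs_def run_on_def)

lemma qs_ne: "qs \<noteq> []"
  using qs_run by (auto simp: accepting_runs_upto_def accepting_runs_def run_on_def)

text \<open>Each letter still to be read adds at most one state, so \<open>qs\<close> cannot be
  completed.\<close>

lemma run_prob_eq_0_if_short:
  assumes "length (visited \<sigma>) + m < length qs"
  shows "run_prob m \<sigma> x = 0"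
proof (rule word_prob_eq_0)
  fix \<tau> :: "'p list" assume "length \<tau> = m"
  moreover obtain zs where "visited (\<sigma> @ \<tau>) = visited \<sigma> @ zs" "length zs \<le> length \<tau>"
    using destutter_append[of "delta A" "hd qs" \<sigma> \<tau>] by auto
  ultimately have "length (visited (\<sigma> @ \<tau>)) < length qs"
    using assms by simp
  then show "visited (\<sigma> @ \<tau>) \<noteq> qs" by auto
qed

text \<open>Visited states are never removed, so a deviation from \<open>qs\<close> is
  final.\<close>

lemma run_prob_eq_0_if_not_prefix:
  assumes "visited \<sigma> \<noteq> take (length (visited \<sigma>)) qs"
  shows "run_prob m \<sigma> x = 0"
proof (rule word_prob_eq_0)
  fix \<tau> :: "'p list"
  obtain zs where "visited (\<sigma> @ \<tau>) = visited \<sigma> @ zs"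
    using destutter_append[of "delta A" "hd qs" \<sigma> \<tau>] by auto
  then have "take (length (visited \<sigma>)) (visited (\<sigma> @ \<tau>)) = visited \<sigma>"
    by simp
  with assms show "visited (\<sigma> @ \<tau>) \<noteq> qs" by metis
qed

text \<open>From \<open>qs ! j\<close> the next letter loops, leads to \<open>qs ! (j + 1)\<close>,
  or leaves \<open>qs\<close> for good.\<close>

lemma run_prob_Suc_cases:
  assumes "j + 1 < length qs" and "visited \<sigma> = take (j + 1) qs" and "x \<in> topspace X"
  obtains (stay) "delta A (qs ! j) (L x) = qs ! j" "visited (\<sigma> @ [L x]) = take (j + 1) qs"
  | (move) "L x \<in> labels A (qs ! j) (qs ! (j + 1))" "visited (\<sigma> @ [L x]) = take (j + 2) qs"
  | (dead) "run_prob (Suc m) \<sigma> x = 0"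
proof -
  let ?q = "delta A (qs ! j) (L x)"
  have last: "last (visited \<sigma>) = qs ! j"
    using assms(1,2) by (simp add: take_Suc_conv_app_nth)
  consider "?q = qs ! j" | "?q = qs ! (j + 1)" "?q \<noteq> qs ! j" | "?q \<noteq> qs ! j" "?q \<noteq> qs ! (j + 1)"
    by blast
  then show thesis
  proof cases
    case 1
    with last assms(2) show thesis by (intro stay) (simp_all add: destutter_step_def)
  next
    case 2
    with last assms show thesis
      by (intro move) (simp_all add: destutter_step_def labels_def alphabet_A L_in_AP take_Suc_conv_app_nth)
  next
    case 3
    have "visited (\<sigma> @ [L x]) = take (j + 1) qs @ [?q]"
      using 3 last assms(2) by (simp add: destutter_step_def)
    moreover from this have "length (visited (\<sigma> @ [L x])) = j + 2"
      using assms(1) by simp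
    moreover have "take (j + 2) qs = take (j + 1) qs @ [qs ! (j + 1)]"
      using assms(1) by (simp add: take_Suc_conv_app_nth)
    ultimately have "visited (\<sigma> @ [L x]) \<noteq> take (length (visited (\<sigma> @ [L x]))) qs"
      using 3 by simp
    then have "run_prob m (\<sigma> @ [L x]) y = 0" for y
      by (rule run_prob_eq_0_if_not_prefix)
    then show thesis by (intro dead) simp
  qed
qed

text \<open>A constant that bounds every correct exit from \<open>qs ! j\<close> survives any number
  of self-loops, since averaging over the noise preserves constants. This covers the wait in the
  initial state and yields the cut-off factor 1 in \<open>stage_bound\<close>.\<close>

lemma run_prob_le_next:
  assumes "j + 1 < length qs" and "0 \<le> C"
    and leave: "\<And>\<sigma> m x. \<lbrakk>\<sigma> \<in> lists AP; visited \<sigma> = take (j + 2) qs; m + j + 1 \<le> N; x \<in> topspace X;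
        L x \<in> labels A (qs ! j) (qs ! (j + 1))\<rbrakk> \<Longrightarrow>
        (\<integral>\<^sup>+v. run_prob m \<sigma> (f (x, v)) \<partial>noise) \<le> ennreal C"
    and "\<sigma> \<in> lists AP" "visited \<sigma> = take (j + 1) qs" "m + j \<le> N" "x \<in> topspace X"
  shows "run_prob m \<sigma> x \<le> ennreal C"
  using assms(4-)
proof (induction m arbitrary: \<sigma> x)
  case 0
  \<comment> \<open>No letters are left while \<open>qs ! (j + 1)\<close> is still missing.\<close>
  then show ?case using assms(1) by (subst run_prob_eq_0_if_short) auto
next
  case (Suc m)
  have word: "\<sigma> @ [L x] \<in> lists AP" using Suc.prems L_in_AP by simp
  from assms(1) Suc.prems(2,4) show ?case
  proof (cases rule: run_prob_Suc_cases[where m = m])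
    case stay
    have "run_prob m (\<sigma> @ [L x]) y \<le> ennreal C" if "y \<in> topspace X" for y
      using word stay(2) Suc.prems(3) that by (intro Suc.IH) auto
    then show ?thesis
      using Suc.prems(4) by (simp add: nn_integral_noise_le_const)
  next
    case move
    with leave[OF word] Suc.prems show ?thesis by simp
  qed simp
qed

text \<open>The label of \<open>x\<close> moves the run into \<open>qs ! (i + 1)\<close>; in the
  applications \<open>\<sigma>\<close> ends with that label. The wait that follows is bounded by
  \<open>C\<close> alone and by the barrier, and the smaller bound is kept.\<close>

lemma stage_bound:
  fixes B :: "'x \<Rightarrow> real" and \<gamma> c C :: real
  assumes i: "i + 2 < length qs" and nonneg: "0 \<le> \<gamma>" "0 \<le> c" "0 \<le> C"
    and B: "B \<in> borel_measurable (borel_sigma X)" "\<And>x. x \<in> topspace X \<Longrightarrow> 0 \<le> B x"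
      "c_martingale M X w f c B"
    and start: "\<And>x. x \<in> topspace X \<Longrightarrow> L x \<in> labels A (qs ! i) (qs ! (i + 1)) \<Longrightarrow> B x \<le> \<gamma>"
    and target: "\<And>x. x \<in> topspace X \<Longrightarrow> L x \<in> labels A (qs ! (i + 1)) (qs ! (i + 2)) \<Longrightarrow> 1 \<le> B x"
    and leave: "\<And>\<sigma> m x. \<lbrakk>\<sigma> \<in> lists AP; visited \<sigma> = take (i + 3) qs; m + i + 2 \<le> N; x \<in> topspace X;
        L x \<in> labels A (qs ! (i + 1)) (qs ! (i + 2))\<rbrakk> \<Longrightarrow>
        (\<integral>\<^sup>+v. run_prob m \<sigma> (f (x, v)) \<partial>noise) \<le> ennreal C"
    and \<sigma>: "\<sigma> \<in> lists AP" "visited \<sigma> = take (i + 2) qs" "m + i + 1 \<le> N"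
    and x: "x \<in> topspace X" "L x \<in> labels A (qs ! i) (qs ! (i + 1))"
  shows "(\<integral>\<^sup>+v. run_prob m \<sigma> (f (x, v)) \<partial>noise)
    \<le> ennreal (min 1 (\<gamma> + c * real (horizon A N qs (qs ! (i + 1)))) * C)"
proof -
  let ?q = "qs ! (i + 1)" and ?r = "length qs - (i + 2)"
  define T where "T = horizon A N qs ?q"
  have leave': "(\<integral>\<^sup>+v. run_prob m \<sigma> (f (x, v)) \<partial>noise) \<le> ennreal C"
    if "\<sigma> \<in> lists AP" "visited \<sigma> = take (i + 1 + 2) qs" "m + (i + 1) + 1 \<le> N" "x \<in> topspace X"
      "L x \<in> labels A (qs ! (i + 1)) (qs ! (i + 1 + 1))" for \<sigma> m x
    using that by (intro leave) (simp_all add: numeral_eq_Suc)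
  have trivial: "(\<integral>\<^sup>+v. run_prob m \<sigma> (f (x, v)) \<partial>noise) \<le> ennreal C"
  proof (intro nn_integral_noise_le_const x(1))
    fix y assume y: "y \<in> topspace X"
    have "i + 1 + 1 < length qs" "visited \<sigma> = take (i + 1 + 1) qs" "m + (i + 1) \<le> N"
      using i \<sigma> by (simp_all add: numeral_eq_Suc)
    then show "run_prob m \<sigma> y \<le> ennreal C"
      using run_prob_le_next[OF _ nonneg(3) leave' \<sigma>(1) _ _ y] by blast
  qed
  \<comment> \<open>A visit to \<open>?q\<close> must leave \<open>?r\<close> letters for the rest of the run, so only \<open>m - ?r\<close> self-loops
    are possible, and none if \<open>?q\<close> has no self-loop.\<close>
  define t where "t m = (if ?q \<in> self_loop_states A then m - ?r else 0)" for m
  have barrier: "run_prob m \<sigma> y \<le> ennreal (C * (B y + c * real (t m)))"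
    if "\<sigma> \<in> lists AP" "visited \<sigma> = take (i + 2) qs" "m + i + 1 \<le> N" "y \<in> topspace X" for m \<sigma> y
    using that
  proof (induction m arbitrary: \<sigma> y)
    case 0
    then show ?case using i by (subst run_prob_eq_0_if_short) auto
  next
    case (Suc m)
    have word: "\<sigma> @ [L y] \<in> lists AP" using Suc.prems L_in_AP by simp
    have "i + 1 + 1 < length qs" "visited \<sigma> = take (i + 1 + 1) qs"
      using i Suc.prems(2) by (simp_all add: numeral_eq_Suc)
    then show ?case using Suc.prems(4)
    proof (cases rule: run_prob_Suc_cases[where m = m])
      case stay
      have loop: "?q \<in> self_loop_states A"
        using stay(1) i L_in_AP[OF Suc.prems(4)]
        by (auto simp: self_loop_states_def alphabet_A qs_in_states)
      show ?thesis
      \<comment> \<open>For \<open>m < ?r\<close> the truncated difference does not grow by 1, but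
        then too few letters remain and the probability is 0. Otherwise the loop uses one unit of
        \<open>t\<close>, which pays for the increment \<open>c\<close>.\<close>
      proof (cases "m < ?r")
        case True
        then have "run_prob m (\<sigma> @ [L y]) z = 0" for z
          using stay(2) i by (intro run_prob_eq_0_if_short) (simp del: destutter_snoc)
        then show ?thesis by simp
      next
        case False
        then have "t (Suc m) = Suc (t m)" using loop by (simp add: t_def)
        moreover have "run_prob m (\<sigma> @ [L y]) z \<le> ennreal (C * (B z + c * real (t m)))"
          if "z \<in> topspace X" for z
          using word stay(2) i Suc.prems(3) that by (intro Suc.IH) (simp_all add: numeral_eq_Suc del: destutter_snoc)
        then have "run_prob (Suc m) \<sigma> y \<le> ennreal (C * (B y + c + c * real (t m)))"
          using nonneg by (simp add: nn_integral_noise_le_barrier[OF B(3,1,2) Suc.prems(4)] del: destutter_snoc)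
        ultimately show ?thesis by (simp add: algebra_simps)
      qed
    next
      case move
      have "run_prob (Suc m) \<sigma> y \<le> ennreal C"
        using leave'[OF word move(2)] move(1) Suc.prems by (simp del: destutter_snoc)
      \<comment> \<open>On leaving towards \<open>qs ! (i + 2)\<close> the barrier is at least
        1.\<close>
      also have "C * 1 \<le> C * (B y + c * real (t (Suc m)))"
        using target[of y] move(1) Suc.prems nonneg
        by (intro mult_left_mono) (auto simp: numeral_eq_Suc intro: add_increasing2)
      then have "ennreal C \<le> ennreal (C * (B y + c * real (t (Suc m))))"
        by (intro ennreal_leI) simp
      finally show ?thesis .
    qed simp
  qed
  have "(\<integral>\<^sup>+v. run_prob m \<sigma> (f (x, v)) \<partial>noise) \<le> ennreal (C * (B x + c + c * real (t m)))"
    using \<sigma> nonneg by (intro nn_integral_noise_le_barrier B x barrier) auto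
  also have "\<dots> \<le> ennreal (C * (\<gamma> + c * real T))"
  proof (intro ennreal_leI mult_left_mono nonneg)
    \<comment> \<open>From \<open>m + i + 1 \<le> N\<close> at most \<open>N + 1 - length qs\<close>
      loops fit, one less than the horizon of a state with a self-loop; the extra 1 is the
      transition out of \<open>x\<close>. If \<open>t m\<close> is 0, \<open>length_qs\<close> keeps
      the horizon at least 1.\<close>
    have "t m + 1 \<le> T"
      using \<sigma>(3) i length_qs by (auto simp: t_def T_def horizon_def)
    then have "c * real (t m + 1) \<le> c * real T"
      using nonneg by (intro mult_left_mono) auto
    then show "B x + c + c * real (t m) \<le> \<gamma> + c * real T"
      using start[OF x] by (simp add: algebra_simps)
  qed
  finally show ?thesis
    using trivial unfolding T_def[symmetric] by (cases "\<gamma> + c * real T \<le> 1") (auto simp: mult.commute min_def)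
qed

definition triple :: "nat \<Rightarrow> 'q \<times> 'q \<times> 'q \<times> nat" where
  "triple i = (qs ! i, qs ! (i + 1), qs ! (i + 2), horizon A N qs (qs ! (i + 1)))"

lemma triples_eq: "triples A N qs = triple ` {..<length qs - 2}"
  by (auto simp: triples_def triple_def image_iff Bex_def)

text \<open>Stages are treated from the last to the first: the bound for the stages after
  \<open>i\<close> becomes the constant \<open>C\<close> of stage \<open>i\<close>.\<close>

lemma run_prob_le_prod:
  fixes \<gamma> c :: "'q \<times> 'q \<times> 'q \<times> nat \<Rightarrow> real"
  assumes nonneg: "\<And>\<nu>. \<nu> \<in> triples A N qs \<Longrightarrow> 0 \<le> \<gamma> \<nu> \<and> 0 \<le> c \<nu>"
    and barrier: "\<And>q q' q'' T. (q, q', q'', T) \<in> triples A N qs \<Longrightarrow>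
      \<exists>B \<in> borel_measurable (borel_sigma X).
        (\<forall>x \<in> topspace X. 0 \<le> B x) \<and> c_martingale M X w f (c (q, q', q'', T)) B \<and>
        (\<forall>x \<in> topspace X. L x \<in> labels A q q' \<longrightarrow> B x \<le> \<gamma> (q, q', q'', T)) \<and>
        (\<forall>x \<in> topspace X. L x \<in> labels A q' q'' \<longrightarrow> 1 \<le> B x)"
    and "x0 \<in> topspace X"
  shows "run_prob N [] x0
    \<le> ennreal (\<Prod>(q, q', q'', T) \<in> triples A N qs. \<gamma> (q, q', q'', T) + c (q, q', q'', T) * real T)"
proof -
  define b where "b = (\<lambda>(q, q', q'', T). \<gamma> (q, q', q'', T) + c (q, q', q'', T) * real T)"
  let ?K = "length qs - 2"
  \<comment> \<open>The tail product from stage \<open>i\<close> on. It runs over positions, and the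
    cut-off stays until the end, where repeated triples are merged.\<close>
  define D where "D i = (\<Prod>k\<in>{i..<?K}. min 1 (b (triple k)))" for i
  have b_nonneg: "0 \<le> b \<nu>" if "\<nu> \<in> triples A N qs" for \<nu>
    using nonneg[OF that] by (auto simp: b_def split: prod.split)
  have triple: "triple i \<in> triples A N qs" if "i < ?K" for i
    using that by (auto simp: triples_eq)
  have D_nonneg: "0 \<le> D i" for i
    unfolding D_def by (intro prod_nonneg) (use b_nonneg triple in auto)
  have "run_prob N [] x0 \<le> ennreal (D 0)"
  proof (cases "2 \<le> length qs")
    case False
    then have "D 0 = 1" by (simp add: D_def)
    then show ?thesis by (simp add: word_prob_le_1)
  next
    case True
    \<comment> \<open>At \<open>i = ?K\<close> the run has just entered its last state, and only the
      trivial bound 1 is left.\<close>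
    have enter: "(\<integral>\<^sup>+v. run_prob m \<sigma> (f (x, v)) \<partial>noise) \<le> ennreal (D i)"
      if "i \<le> ?K" "\<sigma> \<in> lists AP" "visited \<sigma> = take (i + 2) qs" "m + i + 1 \<le> N" "x \<in> topspace X"
        "L x \<in> labels A (qs ! i) (qs ! (i + 1))" for i \<sigma> m x
      using that
    proof (induction i arbitrary: \<sigma> m x rule: inc_induct)
      case base
      have "D ?K = 1" by (simp add: D_def)
      then show ?case
        using base.prems word_prob_le_1 by (intro nn_integral_noise_le_const) simp_all
    next
      case (step i)
      let ?\<nu> = "triple i"
      obtain B where B: "B \<in> borel_measurable (borel_sigma X)" "\<And>x. x \<in> topspace X \<Longrightarrow> 0 \<le> B x"
        "c_martingale M X w f (c ?\<nu>) B"
        "\<And>x. x \<in> topspace X \<Longrightarrow> L x \<in> labels A (qs ! i) (qs ! (i + 1)) \<Longrightarrow> B x \<le> \<gamma> ?\<nu>"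
        "\<And>x. x \<in> topspace X \<Longrightarrow> L x \<in> labels A (qs ! (i + 1)) (qs ! (i + 2)) \<Longrightarrow> 1 \<le> B x"
        using barrier[OF triple[OF step.hyps(2), unfolded triple_def]] unfolding triple_def[symmetric]
        by blast
      have leave: "(\<integral>\<^sup>+v. run_prob m \<sigma> (f (x, v)) \<partial>noise) \<le> ennreal (D (Suc i))"
        if "\<sigma> \<in> lists AP" "visited \<sigma> = take (i + 3) qs" "m + i + 2 \<le> N" "x \<in> topspace X"
          "L x \<in> labels A (qs ! (i + 1)) (qs ! (i + 2))" for \<sigma> m x
        using that by (intro step.IH) (simp_all add: numeral_eq_Suc)
      have "i + 2 < length qs" using step.hyps(2) by simp
      then have "(\<integral>\<^sup>+v. run_prob m \<sigma> (f (x, v)) \<partial>noise)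
          \<le> ennreal (min 1 (\<gamma> ?\<nu> + c ?\<nu> * real (horizon A N qs (qs ! (i + 1)))) * D (Suc i))"
        using nonneg[OF triple[OF step.hyps(2)]]
        by (intro stage_bound[where B = B] B leave step.prems D_nonneg) auto
      also have "\<gamma> ?\<nu> + c ?\<nu> * real (horizon A N qs (qs ! (i + 1))) = b ?\<nu>"
        by (simp add: b_def triple_def)
      also have "min 1 (b ?\<nu>) * D (Suc i) = D i"
        unfolding D_def by (rule prod.atLeast_Suc_lessThan[OF step.hyps(2), symmetric])
      finally show ?case .
    qed
    have start: "visited [] = take (0 + 1) qs"
      using qs_ne by (cases qs) auto
    show ?thesis
    \<comment> \<open>Waiting in \<open>qs ! 0\<close> contributes no factor.\<close>
    proof (rule run_prob_le_next[where j = 0])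
      show "0 + 1 < length qs" using True by simp
      show "(\<integral>\<^sup>+v. run_prob m \<sigma> (f (x, v)) \<partial>noise) \<le> ennreal (D 0)"
        if "\<sigma> \<in> lists AP" "visited \<sigma> = take (0 + 2) qs" "m + 0 + 1 \<le> N" "x \<in> topspace X"
          "L x \<in> labels A (qs ! 0) (qs ! (0 + 1))" for \<sigma> m x
        using that by (intro enter) simp_all
    qed (use start D_nonneg assms(3) in simp_all)
  qed
  also have "D 0 \<le> (\<Prod>\<nu>\<in>triples A N qs. b \<nu>)"
    unfolding D_def atLeast0LessThan using b_nonneg
    unfolding triples_eq by (intro prod_min_one_le_prod_image) auto
  then have "ennreal (D 0) \<le> ennreal (\<Prod>\<nu>\<in>triples A N qs. b \<nu>)"
    by (rule ennreal_leI)
  finally show ?thesis by (simp add: b_def)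
qed

end

section \<open>Union bound over the destuttered runs\<close>

theorem theorem2:
  fixes M :: "'o measure" and X :: "'x topology" and V :: "'v topology"
    and w :: "nat \<Rightarrow> 'o \<Rightarrow> 'v" and f :: "'x \<times> 'v \<Rightarrow> 'x"
    and AP :: "'p set" and L :: "'x \<Rightarrow> 'p" and x0 :: 'x and N :: nat
    and \<phi> :: "'p ltlf" and A :: "('q, 'p) dfa"
    and \<gamma> c :: "'q \<times> 'q \<times> 'q \<times> nat \<Rightarrow> real"
  assumes "stochastic_system M X V w f"
    and "finite AP"
    and "L \<in> borel_sigma X \<rightarrow>\<^sub>M count_space AP"
    and "x0 \<in> topspace X"
    and "N \<ge> 1"
    and "set_ltlf \<phi> \<subseteq> AP"
    and "safe_ltlf AP \<phi>"
    and "wf_dfa A"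
    and "alphabet A = AP"
    and "\<And>\<sigma>. \<sigma> \<in> lists AP \<Longrightarrow> \<sigma> \<noteq> [] \<Longrightarrow> accepts A \<sigma> \<longleftrightarrow> \<sigma> \<Turnstile>\<^sub>F LNot \<phi>"
    and "\<And>qs q q' q'' T. qs \<in> accepting_runs_upto A N \<Longrightarrow> (q, q', q'', T) \<in> triples A N qs \<Longrightarrow>
           0 \<le> \<gamma> (q, q', q'', T) \<and> \<gamma> (q, q', q'', T) \<le> 1 \<and> 0 \<le> c (q, q', q'', T) \<and>
           (\<exists>B \<in> borel_measurable (borel_sigma X).
              (\<forall>x \<in> topspace X. 0 \<le> B x) \<and>
              c_martingale M X w f (c (q, q', q'', T)) B \<and>
              (\<forall>x \<in> topspace X. L x \<in> labels A q q' \<longrightarrow> B x \<le> \<gamma> (q, q', q'', T)) \<and>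
              (\<forall>x \<in> topspace X. L x \<in> labels A q' q'' \<longrightarrow> 1 \<le> B x))"
  shows "\<P>(\<omega> in M. sol_trace w f L x0 N \<omega> \<Turnstile>\<^sub>F LNot \<phi>)
         \<le> (\<Sum>qs \<in> accepting_runs_upto A N.
              \<Prod>(q, q', q'', T) \<in> triples A N qs.
                \<gamma> (q, q', q'', T) + c (q, q', q'', T) * real T)"
proof -
  interpret labelled_system M X V w f AP L
    using assms(1-3) by (intro labelled_system.intro labelled_system_axioms.intro)
  let ?R = "accepting_runs_upto A N"
  let ?bound = "\<lambda>qs. \<Prod>(q, q', q'', T) \<in> triples A N qs. \<gamma> (q, q', q'', T) + c (q, q', q'', T) * real T"
  let ?trace = "sol_trace w f L x0 N"
  \<comment> \<open>Reading starts at \<open>hd qs\<close> because the automaton may have several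
    initial states. The events may then overlap, which a union bound tolerates.\<close>
  define E where "E qs = {\<omega> \<in> space M. destutter (delta A) (hd qs) (?trace \<omega>) = qs}" for qs
  have trace: "?trace \<in> M \<rightarrow>\<^sub>M count_space (lists AP)"
    by (intro measurable_sol_trace measurable_w assms(4))
  have trace_words: "?trace \<omega> \<in> lists AP" if "\<omega> \<in> space M" for \<omega>
    using measurable_space[OF trace that] by simp
  have length_trace: "length (?trace \<omega>) = N" for \<omega>
    by (simp add: sol_trace_def)
  have finite: "finite ?R"
    by (rule finite_accepting_runs_upto[OF assms(8)])
  have E_sets: "E qs \<in> sets M" for qs
  proof -
    have "E qs = ?trace -` {\<sigma> \<in> lists AP. destutter (delta A) (hd qs) \<sigma> = qs} \<inter> space M"
      using trace_words by (auto simp: E_def)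
    then show ?thesis
      using measurable_sets[OF trace, of "{\<sigma> \<in> lists AP. destutter (delta A) (hd qs) \<sigma> = qs}"] by auto
  qed
  have E_bound: "prob (E qs) \<le> ?bound qs" if qs: "qs \<in> ?R" for qs
  proof -
    interpret run: labelled_system_run M X V w f AP L A N qs
      by unfold_locales (fact assms(9) qs)+
    have nonneg: "0 \<le> \<gamma> \<nu> \<and> 0 \<le> c \<nu>" if "\<nu> \<in> triples A N qs" for \<nu>
      using assms(11)[OF qs] that by (cases \<nu>) blast
    have "emeasure M (E qs) = run.run_prob N [] x0"
      unfolding E_def by (rule emeasure_sol_trace[OF assms(4)])
    also have "\<dots> \<le> ennreal (?bound qs)"
      by (rule run.run_prob_le_prod[OF nonneg _ assms(4)]) (use assms(11)[OF qs] in blast)+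
    finally have "emeasure M (E qs) \<le> ennreal (?bound qs)" .
    \<comment> \<open>\<open>ennreal\<close> sends negative reals to 0, so the return to real
      numbers needs a nonnegative bound.\<close>
    moreover have "0 \<le> ?bound qs"
      using nonneg by (intro prod_nonneg) auto
    ultimately show ?thesis
      by (simp add: emeasure_eq_measure)
  qed
  have "{\<omega> \<in> space M. ?trace \<omega> \<Turnstile>\<^sub>F LNot \<phi>} \<subseteq> (\<Union>qs\<in>?R. E qs)"
  proof
    fix \<omega> assume \<omega>: "\<omega> \<in> {\<omega> \<in> space M. ?trace \<omega> \<Turnstile>\<^sub>F LNot \<phi>}"
    \<comment> \<open>\<open>N \<ge> 1\<close> makes the trace non-empty, as the language of
      \<open>A\<close> is prescribed on non-empty words only.\<close>
    then have "?trace \<omega> \<in> lists AP" "?trace \<omega> \<noteq> []"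
      using trace_words length_trace[of \<omega>] assms(5) by auto
    then obtain rs where "run_on A (?trace \<omega>) rs"
      using \<omega> assms(10) by (auto simp: accepts_def)
    then have "destutter (delta A) (hd rs) (?trace \<omega>) \<in> ?R"
      using destutter_run_on[OF assms(8)] trace_words \<omega> length_trace assms(9) by fastforce
    then show "\<omega> \<in> (\<Union>qs\<in>?R. E qs)"
      using \<omega> by (intro UN_I) (auto simp: E_def)
  qed
  then have "\<P>(\<omega> in M. ?trace \<omega> \<Turnstile>\<^sub>F LNot \<phi>) \<le> prob (\<Union>qs\<in>?R. E qs)"
    using E_sets finite by (intro finite_measure_mono) auto
  also have "\<dots> \<le> (\<Sum>qs\<in>?R. prob (E qs))"
    using E_sets finite by (intro finite_measure_subadditive_finite) auto
  also have "\<dots> \<le> (\<Sum>qs\<in>?R. ?bound qs)"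
    by (intro sum_mono E_bound)
  finally show ?thesis .
qed

end
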